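(* Let $\mathcal A=\{p_1,\dots,p_n\}$ be a planar point set in general position with $n\ge 4$, and with $p_1,p_2$ having different second coordinates. A vector $f\in\mathbb R^{\binom{n+1}{2}}$ is valid if and only if, for every four points $\{p_a,p_b,p_c,p_d\}$ of $\mathcal A$, $$\sum_{i<j,\ i,j\in\{a,b,c,d\}}w_{ij}f_{ij}+\sum_{j\in\{a,b,c,d\}}\alpha_jf_{0j}>0.$$ Here $w_{ij}$ and $\alpha_j$ are computed within these four points as follows: - $w_{ij}=1/\big(\det(p_i,p_j,p_k)\det(p_i,p_j,p_l)\big)$, where $\{k,l\}$ are the other two indices; - $\alpha_j=\sum_{i\ne j}w_{ij}|p_i-p_j|$, the sum running over the other three indices.
   Context: $\det(x,y,z)$ is the determinant of the $3\times 3$ matrix with columns $(x,1),(y,1),(z,1)$. Let $S=\{(v,t)\in(\mathbb R^2)^n\times\mathbb R^n: v_1^1=v_1^2=v_2^1=0\}$. For $f=(f_{ij})_{0\le i<j\le n}$, the polyhedron $\overline{Y_f}(\mathcal A)$ is the set of $(v,t)\in S$ satisfying both of: - $\langle p_i-p_j,v_i-v_j\rangle-|p_i-p_j|(t_i+t_j)\ge f_{ij}$ for $1\le i<j\le n$; - $t_j\ge f_{0j}$ for all $j$. The tight marked graph of a face consists of: - the edges $p_ip_j$ whose inequality holds with equality on the relative interior of the face; - the marks at the points $p_j$ whose inequality $t_j\ge f_{0j}$ holds with equality there. A marked graph is non-crossing if no two edges cross and every marked vertex is pointed, i.e. its incident edges span an angle smaller than $180^\circ$. The choice $f$ is valid if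 every face of $\overline{Y_f}(\mathcal A)$ has a non-crossing tight marked graph. *)

theory Defs
  imports "HOL-Analysis.Analysis"
begin

definition det3 :: "real^2 \<Rightarrow> real^2 \<Rightarrow> real^2 \<Rightarrow> real" where
  "det3 x y z =
     (let c = (\<lambda>q::real^2. vector [q$1, q$2, 1] :: real^3);
          cols = (vector [c x, c y, c z] :: (real^3)^3)
      in det (\<chi> r s. cols $ s $ r))"

text \<open>Points indexed by a finite linearly ordered type 'i; i1, i2 play the roles of p_1, p_2.
  f i j (for i < j) is f_ij; f0 j is f_0j.  A point of (R^2)^n x R^n is a pair (v,t).\<close>
definition Ybar ::
  "('i::{finite,linorder} \<Rightarrow> real^2) \<Rightarrow> 'i::{finite,linorder} \<Rightarrow> 'i::{finite,linorder} \<Rightarrow> ('i::{finite,linorder} \<Rightarrow> 'i::{finite,linorder} \<Rightarrow> real) \<Rightarrow> ('i::{finite,linorder} \<Rightarrow> real)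
    \<Rightarrow> (((real^2)^'i::{finite,linorder}) \<times> (real^'i::{finite,linorder})) set" where
  "Ybar p i1 i2 f f0 =
     {(v, t). v $ i1 $ 1 = 0 \<and> v $ i1 $ 2 = 0 \<and> v $ i2 $ 1 = 0 \<and>
        (\<forall>i j. i < j \<longrightarrow>
           inner (p i - p j) (v $ i - v $ j) - norm (p i - p j) * (t $ i + t $ j) \<ge> f i j) \<and>
        (\<forall>j. t $ j \<ge> f0 j)}"

definition tight_edges ::
  "('i::{finite,linorder} \<Rightarrow> real^2) \<Rightarrow> ('i::{finite,linorder} \<Rightarrow> 'i::{finite,linorder} \<Rightarrow> real) \<Rightarrow> (((real^2)^'i::{finite,linorder}) \<times> (real^'i::{finite,linorder})) set
    \<Rightarrow> ('i::{finite,linorder} \<times> 'i::{finite,linorder}) set" where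
  "tight_edges p f F =
     {(i, j). i < j \<and> (\<forall>(v, t) \<in> rel_interior F.
        inner (p i - p j) (v $ i - v $ j) - norm (p i - p j) * (t $ i + t $ j) = f i j)}"

definition tight_marks ::
  "('i::{finite,linorder} \<Rightarrow> real) \<Rightarrow> (((real^2)^'i::{finite,linorder}) \<times> (real^'i::{finite,linorder})) set \<Rightarrow> 'i::{finite,linorder} set" where
  "tight_marks f0 F = {j. \<forall>(v, t) \<in> rel_interior F. t $ j = f0 j}"

definition edges_cross :: "('i::{finite,linorder} \<Rightarrow> real^2) \<Rightarrow> 'i::{finite,linorder} \<times> 'i::{finite,linorder} \<Rightarrow> 'i::{finite,linorder} \<times> 'i::{finite,linorder} \<Rightarrow> bool" where
  "edges_cross p e e' =
     ({fst e, snd e} \<inter> {fst e', snd e'} = {} \<and>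
      closed_segment (p (fst e)) (p (snd e)) \<inter> closed_segment (p (fst e')) (p (snd e')) \<noteq> {})"

text \<open>A vertex is pointed if its incident edges span an angle smaller than 180 degrees,
  i.e. all edge directions lie in an open half-plane.\<close>
definition pointed :: "('i::{finite,linorder} \<Rightarrow> real^2) \<Rightarrow> ('i::{finite,linorder} \<times> 'i::{finite,linorder}) set \<Rightarrow> 'i::{finite,linorder} \<Rightarrow> bool" where
  "pointed p E j =
     (\<exists>u::real^2. \<forall>i. ((i, j) \<in> E \<or> (j, i) \<in> E) \<longrightarrow> inner u (p i - p j) > 0)"

definition non_crossing :: "('i::{finite,linorder} \<Rightarrow> real^2) \<Rightarrow> ('i::{finite,linorder} \<times> 'i::{finite,linorder}) set \<Rightarrow> 'i::{finite,linorder} set \<Rightarrow> bool" where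
  "non_crossing p E M =
     ((\<forall>e\<in>E. \<forall>e'\<in>E. \<not> edges_cross p e e') \<and> (\<forall>j\<in>M. pointed p E j))"

definition valid ::
  "('i::{finite,linorder} \<Rightarrow> real^2) \<Rightarrow> 'i::{finite,linorder} \<Rightarrow> 'i::{finite,linorder} \<Rightarrow> ('i::{finite,linorder} \<Rightarrow> 'i::{finite,linorder} \<Rightarrow> real) \<Rightarrow> ('i::{finite,linorder} \<Rightarrow> real) \<Rightarrow> bool" where
  "valid p i1 i2 f f0 =
     (\<forall>F. F face_of Ybar p i1 i2 f f0 \<and> F \<noteq> {} \<longrightarrow>
          non_crossing p (tight_edges p f F) (tight_marks f0 F))"

definition wQ :: "('i::{finite,linorder} \<Rightarrow> real^2) \<Rightarrow> 'i::{finite,linorder} set \<Rightarrow> 'i::{finite,linorder} \<Rightarrow> 'i::{finite,linorder} \<Rightarrow> real" where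
  "wQ p Q i j = 1 / (\<Prod>k \<in> Q - {i, j}. det3 (p i) (p j) (p k))"

definition alphaQ :: "('i::{finite,linorder} \<Rightarrow> real^2) \<Rightarrow> 'i::{finite,linorder} set \<Rightarrow> 'i::{finite,linorder} \<Rightarrow> real" where
  "alphaQ p Q j = (\<Sum>i \<in> Q - {j}. wQ p Q i j * norm (p i - p j))"

definition general_position :: "('i::{finite,linorder} \<Rightarrow> real^2) \<Rightarrow> bool" where
  "general_position p =
     (inj p \<and> (\<forall>i j k. i \<noteq> j \<and> j \<noteq> k \<and> i \<noteq> k \<longrightarrow> \<not> collinear {p i, p j, p k}))"

end

theory Submission
  imports Defs
begin

text \<open>On four points the weights \<open>w\<close>, \<open>\<alpha>\<close> form the unique linear dependence among the constraint
  functionals, so for every point of the polyhedron the weighted sum of the slacks is minus the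
  circuit value \<open>\<Sum> w f + \<Sum> \<alpha> f0\<close>. A crossing, or a marked non-pointed vertex, annihilates exactly
  the slacks of negative weight; hence a positive circuit value excludes it.

  Conversely, among five points the circuit value of the four points other than \<open>p\<^sub>i\<close> is an affine
  function of \<open>p\<^sub>i\<close>. So if some quadruple has value \<open>\<le> 0\<close>, there is one whose convex hull contains
  no further point of the configuration: a point in the hull can replace a hull vertex. On such a
  quadruple all constraints but one of positive weight can be made tight, and this motion extends to the
  remaining points by expanding them away from the hull, giving a face with a forbidden graph.\<close>

subsection \<open>Weights of a quadruple\<close>

lemma det3_eq:
  "det3 x y z = (y$1 - x$1) * (z$2 - x$2) - (y$2 - x$2) * (z$1 - x$1)"
  by (simp add: det3_def det_3 algebra_simps)

lemma det3_nonzero: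
  assumes gp: "general_position p" and "i \<noteq> j" "j \<noteq> k" "i \<noteq> k"
  shows "det3 (p i) (p j) (p k) \<noteq> 0"
proof
  assume 0: "det3 (p i) (p j) (p k) = 0"
  have ne: "p j - p i \<noteq> 0"
    using assms unfolding general_position_def by (auto dest: injD)
  define a b where "a = p j - p i" and "b = p k - p i"
  have ab: "a$1 * b$2 = a$2 * b$1"
    using 0 by (simp add: det3_eq a_def b_def)
  have "\<exists>c. b = c *\<^sub>R a"
  proof (cases "a$1 = 0")
    case True
    then have "a$2 \<noteq> 0" using ne by (auto simp: a_def[symmetric] vec_eq_iff forall_2)
    then show ?thesis using True ab
      by (intro exI[of _ "b$2 / a$2"]) (auto simp: vec_eq_iff forall_2)
  next
    case False
    then show ?thesis using ab
      by (intro exI[of _ "b$1 / a$1"]) (auto simp: vec_eq_iff forall_2 field_simps)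
  qed
  then have "collinear {0, a, b}"
    by (auto simp: collinear_lemma)
  then have "collinear {p j, p i, p k}"
    by (simp add: collinear_3 a_def b_def)
  then show False
    using assms unfolding general_position_def by (metis insert_commute)
qed

text \<open>Swapping the endpoints negates every determinant in the product. Four points leave
  exactly two factors, so the signs cancel.\<close>

lemma wQ_commute:
  assumes "card Q = 4" "i \<in> Q" "j \<in> Q"
  shows "wQ p Q i j = wQ p Q j i"
proof (cases "i = j")
  case False
  have "finite Q" using assms by (metis card.infinite zero_neq_numeral)
  then have "card (Q - {i, j}) = 2"
    using assms False by (subst card_Diff_subset) auto
  moreover have "(\<Prod>k\<in>Q - {i, j}. det3 (p j) (p i) (p k)) = (\<Prod>k\<in>Q - {i, j}. - det3 (p i) (p j) (p k))"
    by (intro prod.cong) (auto simp: det3_eq algebra_simps)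
  ultimately show ?thesis
    by (simp add: wQ_def prod_uminus insert_commute)
qed auto

lemma wQ_quad:
  assumes "Q = {a, b, c, d}" "distinct [a, b, c, d]"
  shows "wQ p Q a b = 1 / (det3 (p a) (p b) (p c) * det3 (p a) (p b) (p d))"
proof -
  have "Q - {a, b} = {c, d}" using assms by auto
  then show ?thesis using assms by (simp add: wQ_def)
qed

lemma card_4_obtain:
  assumes "card Q = 4" "a \<in> Q"
  obtains b c d where "Q = {a, b, c, d}" "distinct [a, b, c, d]"
proof -
  have "card (Q - {a}) = 3" using assms by simp
  then obtain b c d where "Q - {a} = {b, c, d}" "distinct [b, c, d]"
    by (auto simp: card_3_iff)
  with assms have "Q = {a, b, c, d}" "distinct [a, b, c, d]" by auto
  then show ?thesis by (rule that)
qed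

section \<open>The self-stress of four points\<close>

text \<open>Read \<open>wQ\<close> as force densities on the complete graph. After clearing
  denominators, the balance at \<open>i\<close> is the linear relation between three plane vectors
  whose coefficients are their 2x2 determinants.\<close>

lemma wQ_equilibrium:
  assumes gp: "general_position p" and "card Q = 4" "i \<in> Q"
  shows "(\<Sum>j \<in> Q - {i}. wQ p Q i j *\<^sub>R (p i - p j)) = 0"
proof -
  obtain b c d where Q: "Q = {i, b, c, d}" "distinct [i, b, c, d]"
    using card_4_obtain assms(2,3) .
  have w: "wQ p Q i b = 1 / (det3 (p i) (p b) (p c) * det3 (p i) (p b) (p d))"
      "wQ p Q i c = 1 / (det3 (p i) (p c) (p b) * det3 (p i) (p c) (p d))"
      "wQ p Q i d = 1 / (det3 (p i) (p d) (p b) * det3 (p i) (p d) (p c))"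
    using Q by (auto intro!: wQ_quad)
  define x y z where xyz: "x = det3 (p i) (p b) (p c)" "y = det3 (p i) (p b) (p d)"
      "z = det3 (p i) (p c) (p d)"
  have nz: "x \<noteq> 0" "y \<noteq> 0" "z \<noteq> 0"
    using Q(2) unfolding xyz by (simp_all add: det3_nonzero[OF gp])
  have sw: "det3 (p i) (p c) (p b) = - x" "det3 (p i) (p d) (p b) = - y"
      "det3 (p i) (p d) (p c) = - z"
    by (auto simp: xyz det3_eq algebra_simps)
  have "Q - {i} = {b, c, d}" using Q by auto
  then have "(\<Sum>j \<in> Q - {i}. wQ p Q i j *\<^sub>R (p i - p j)) =
      (1 / (x * y)) *\<^sub>R (p i - p b) - (1 / (x * z)) *\<^sub>R (p i - p c) + (1 / (y * z)) *\<^sub>R (p i - p d)"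
    using Q(2) by (simp add: w sw xyz(1,2,3)[symmetric])
  also have "\<dots> = (1 / (x * y * z)) *\<^sub>R (z *\<^sub>R (p i - p b) - y *\<^sub>R (p i - p c) + x *\<^sub>R (p i - p d))"
    using nz by (simp add: scaleR_right_distrib scaleR_right_diff_distrib)
  also have "z *\<^sub>R (p i - p b) - y *\<^sub>R (p i - p c) + x *\<^sub>R (p i - p d) = 0"
    by (simp add: vec_eq_iff forall_2 xyz det3_eq) algebra
  finally show ?thesis by simp
qed

text \<open>Passes between sums over edges and sums over vertices with their incident edges: each
  unordered pair is met once from either end.\<close>

lemma sum_pairs_split:
  fixes g :: "'i::linorder \<Rightarrow> 'i \<Rightarrow> 'a::comm_monoid_add"
  assumes "finite Q"
  shows "(\<Sum>(i, j) \<in> {(i, j). i \<in> Q \<and> j \<in> Q \<and> i < j}. g i j + g j i) = (\<Sum>i\<in>Q. \<Sum>j\<in>Q - {i}. g i j)"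
proof -
  let ?P = "{(i, j). i \<in> Q \<and> j \<in> Q \<and> i < j}" and ?P' = "{(i, j). i \<in> Q \<and> j \<in> Q \<and> j < i}"
  have fin: "finite ?P" "finite ?P'"
    using assms by (auto intro: finite_subset[of _ "Q \<times> Q"])
  have "(\<Sum>(i, j) \<in> ?P. g j i) = (\<Sum>(i, j) \<in> ?P'. g i j)"
    by (rule sum.reindex_bij_witness[of _ prod.swap prod.swap]) auto
  then have "(\<Sum>(i, j) \<in> ?P. g i j + g j i) = (\<Sum>(i, j) \<in> ?P \<union> ?P'. g i j)"
    by (subst sum.union_disjoint) (use fin in \<open>auto simp: case_prod_unfold sum.distrib\<close>)
  also have "?P \<union> ?P' = Sigma Q (\<lambda>i. Q - {i})" by auto
  finally show ?thesis using assms by (simp add: sum.Sigma)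
qed

text \<open>A stress in equilibrium does no work: collecting terms by vertex pairs each
  \<open>v i\<close> with a vanishing resultant force.\<close>

lemma stress_work_zero:
  assumes gp: "general_position p" and "card Q = 4"
  shows "(\<Sum>(i, j) \<in> {(i, j). i \<in> Q \<and> j \<in> Q \<and> i < j}.
           wQ p Q i j * inner (p i - p j) (v i - v j)) = 0"
proof -
  have "finite Q" using assms by (metis card.infinite zero_neq_numeral)
  have "(\<Sum>(i, j) \<in> {(i, j). i \<in> Q \<and> j \<in> Q \<and> i < j}. wQ p Q i j * inner (p i - p j) (v i - v j))
     = (\<Sum>(i, j) \<in> {(i, j). i \<in> Q \<and> j \<in> Q \<and> i < j}.
          inner (wQ p Q i j *\<^sub>R (p i - p j)) (v i) + inner (wQ p Q j i *\<^sub>R (p j - p i)) (v j))"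
    by (intro sum.cong refl) (auto simp: wQ_commute[OF assms(2)] inner_diff algebra_simps)
  also have "\<dots> = (\<Sum>i\<in>Q. \<Sum>j\<in>Q - {i}. inner (wQ p Q i j *\<^sub>R (p i - p j)) (v i))"
    by (rule sum_pairs_split) fact
  also have "\<dots> = (\<Sum>i\<in>Q. inner (\<Sum>j\<in>Q - {i}. wQ p Q i j *\<^sub>R (p i - p j)) (v i))"
    by (simp only: inner_sum_left)
  also have "\<dots> = 0" using wQ_equilibrium[OF assms] by simp
  finally show ?thesis .
qed

text \<open>This is the reason for the formula of \<open>alphaQ\<close>: with these coefficients the
  marks cancel the \<open>t\<close>-terms of the weighted edge constraints.\<close>

lemma sum_alphaQ:
  assumes "card Q = 4"
  shows "(\<Sum>j \<in> Q. alphaQ p Q j * t j) = (\<Sum>(i, j) \<in> {(i, j). i \<in> Q \<and> j \<in> Q \<and> i < j}.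
           wQ p Q i j * (norm (p i - p j) * (t i + t j)))"
proof -
  have "finite Q" using assms by (metis card.infinite zero_neq_numeral)
  have "(\<Sum>j \<in> Q. alphaQ p Q j * t j) = (\<Sum>i\<in>Q. \<Sum>j\<in>Q - {i}. wQ p Q j i * norm (p j - p i) * t i)"
    by (simp add: alphaQ_def sum_distrib_right)
  also have "\<dots> = (\<Sum>(i, j) \<in> {(i, j). i \<in> Q \<and> j \<in> Q \<and> i < j}.
      wQ p Q j i * norm (p j - p i) * t i + wQ p Q i j * norm (p i - p j) * t j)"
    by (rule sum_pairs_split[symmetric]) fact
  also have "\<dots> = (\<Sum>(i, j) \<in> {(i, j). i \<in> Q \<and> j \<in> Q \<and> i < j}.
           wQ p Q i j * (norm (p i - p j) * (t i + t j)))"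
    by (intro sum.cong refl)
      (auto simp: wQ_commute[OF assms] norm_minus_commute[of "p _" "p _"] algebra_simps)
  finally show ?thesis .
qed

section \<open>Circuit values\<close>

text \<open>Kept in the very form of the criterion to be proved, so that folding this definition
  there suffices.\<close>

definition circuit_val ::
  "('i::{finite,linorder} \<Rightarrow> real^2) \<Rightarrow> ('i \<Rightarrow> 'i \<Rightarrow> real) \<Rightarrow> ('i \<Rightarrow> real) \<Rightarrow> 'i set \<Rightarrow> real" where
  "circuit_val p f f0 Q = (\<Sum>(i, j) \<in> {(i, j). i \<in> Q \<and> j \<in> Q \<and> i < j}. wQ p Q i j * f i j)
       + (\<Sum>j \<in> Q. alphaQ p Q j * f0 j)"

text \<open>Putting \<open>t = f0\<close> in \<open>sum_alphaQ\<close> eliminates the marks. The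
  bracket is the value that \<open>inner (p i - p j) (v i - v j)\<close> takes when the edge and
  both marks are tight.\<close>

lemma circuit_val_eq:
  assumes "card Q = 4"
  shows "circuit_val p f f0 Q = (\<Sum>(i, j) \<in> {(i, j). i \<in> Q \<and> j \<in> Q \<and> i < j}.
           wQ p Q i j * (f i j + norm (p i - p j) * (f0 i + f0 j)))"
  unfolding circuit_val_def sum_alphaQ[OF assms]
  by (simp add: sum.distrib[symmetric] case_prod_unfold distrib_left)

text \<open>The motion drops out by \<open>stress_work_zero\<close> and \<open>t\<close> by
  \<open>sum_alphaQ\<close>; only the right-hand sides of the constraints survive.\<close>

lemma circuit_val_slack:
  assumes gp: "general_position p" and "card Q = 4"
  shows "(\<Sum>(i, j) \<in> {(i, j). i \<in> Q \<and> j \<in> Q \<and> i < j}.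
      wQ p Q i j * (inner (p i - p j) (v i - v j) - norm (p i - p j) * (t i + t j) - f i j))
    + (\<Sum>j \<in> Q. alphaQ p Q j * (t j - f0 j)) = - circuit_val p f f0 Q"
proof -
  have "(\<Sum>j \<in> Q. alphaQ p Q j * (t j - f0 j)) =
     (\<Sum>(i, j) \<in> {(i, j). i \<in> Q \<and> j \<in> Q \<and> i < j}. wQ p Q i j * (norm (p i - p j) * (t i + t j)))
     - (\<Sum>j \<in> Q. alphaQ p Q j * f0 j)"
    by (simp add: sum_alphaQ[OF assms(2), symmetric] right_diff_distrib sum_subtractf)
  then show ?thesis
    using stress_work_zero[OF assms, of v]
    by (simp add: circuit_val_def case_prod_unfold right_diff_distrib sum_subtractf)
qed

text \<open>Writing \<open>D\<close> for \<open>det3\<close>, the weight of the edge \<open>jk\<close> in \<open>R - {i}\<close> is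
  \<open>D p\<^sub>j p\<^sub>k p\<^sub>i\<close> divided by the product of all \<open>D p\<^sub>j p\<^sub>k p\<^sub>l\<close> with \<open>l \<in> R - {j, k}\<close>.
  The numerator is affine in \<open>p\<^sub>i\<close> and vanishes when \<open>i\<close> is \<open>j\<close> or \<open>k\<close>; the denominator does
  not depend on \<open>i\<close>.\<close>
lemma circuit_val_affine:
  assumes gp: "general_position p" and "card R = 5"
  obtains n c where "\<And>i. i \<in> R \<Longrightarrow> circuit_val p f f0 (R - {i}) = inner n (p i) + c"
proof -
  have finR: "finite R" using assms by (metis card.infinite zero_neq_numeral)
  define h where "h j k = (f j k + norm (p j - p k) * (f0 j + f0 k)) /
      (\<Prod>l\<in>R - {j, k}. det3 (p j) (p k) (p l))" for j k
  \<comment> \<open>The edge vector from \<open>p j\<close> to \<open>p k\<close> turned by a right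
    angle, a normal of the line through both points; it exhibits \<open>det3\<close> as affine in
    its third argument.\<close>
  define m where "m j k = (vector [p j $ 2 - p k $ 2, p k $ 1 - p j $ 1] :: real^2)" for j k
  have D: "det3 (p j) (p k) z = inner (m j k) z - inner (m j k) (p j)" for j k z
    by (simp add: det3_eq m_def inner_vec_def sum_2 algebra_simps)
  let ?P = "\<lambda>Q. {(i, j). i \<in> Q \<and> j \<in> Q \<and> i < j}"
  have "circuit_val p f f0 (R - {i}) =
     inner (\<Sum>(j, k)\<in>?P R. h j k *\<^sub>R m j k) (p i) + (\<Sum>(j, k)\<in>?P R. - h j k * inner (m j k) (p j))"
    if i: "i \<in> R" for i
  proof -
    have "card (R - {i}) = 4" using i assms by simp
    then have "circuit_val p f f0 (R - {i}) = (\<Sum>(j, k)\<in>?P (R - {i}).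
        wQ p (R - {i}) j k * (f j k + norm (p j - p k) * (f0 j + f0 k)))"
      by (rule circuit_val_eq)
    also have "\<dots> = (\<Sum>(j, k)\<in>?P (R - {i}). h j k * det3 (p j) (p k) (p i))"
    proof -
      have "wQ p (R - {i}) j k * (f j k + norm (p j - p k) * (f0 j + f0 k)) =
          h j k * det3 (p j) (p k) (p i)"
        if jk: "j \<in> R" "j \<noteq> i" "k \<in> R" "k \<noteq> i" "j < k" for j k
      proof -
      have "(\<Prod>l\<in>R - {j, k}. det3 (p j) (p k) (p l)) =
          det3 (p j) (p k) (p i) * (\<Prod>l\<in>R - {j, k} - {i}. det3 (p j) (p k) (p l))"
        using jk i finR by (intro prod.remove) auto
      moreover have "R - {j, k} - {i} = R - {i} - {j, k}" by auto
      moreover have "det3 (p j) (p k) (p i) \<noteq> 0"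
        using jk by (intro det3_nonzero[OF gp]) auto
      ultimately show ?thesis
        by (simp add: wQ_def h_def)
      qed
      then show ?thesis by (intro sum.cong) auto
    qed
    also have "\<dots> = (\<Sum>(j, k)\<in>?P R. h j k * det3 (p j) (p k) (p i))"
      by (rule sum.mono_neutral_left)
        (auto intro: finite_subset[OF _ finite_cartesian_product[OF finR finR]] simp: det3_eq)
    also have "\<dots> = inner (\<Sum>(j, k)\<in>?P R. h j k *\<^sub>R m j k) (p i)
        + (\<Sum>(j, k)\<in>?P R. - h j k * inner (m j k) (p j))"
      by (simp add: D inner_sum_left case_prod_unfold right_diff_distrib sum_subtractf sum_negf)
    finally show ?thesis .
  qed
  then show ?thesis by (rule that)
qed

subsection \<open>Positive circuit values imply validity\<close>

text \<open>The dependence gives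
  \<open>lc * det3 (p a) (p b) (p c) = - ld * det3 (p a) (p b) (p d)\<close>. Coefficients of
  opposite sign thus put \<open>c\<close> and \<open>d\<close> on the same side of the line
  \<open>ab\<close>, which makes the weight positive.\<close>

lemma wQ_pos:
  assumes gp: "general_position p" and Q: "Q = {a, b, c, d}" "distinct [a, b, c, d]"
    and dep: "la + lb + lc + ld = 0" "la *\<^sub>R p a + lb *\<^sub>R p b + lc *\<^sub>R p c + ld *\<^sub>R p d = 0"
    and opp: "lc * ld < 0"
  shows "wQ p Q a b > 0"
proof -
  have comp: "la * p a $ k + lb * p b $ k + lc * p c $ k + ld * p d $ k = 0" for k
    using arg_cong[OF dep(2), of "\<lambda>x. x $ k"] by simp
  have "lc * det3 (p a) (p b) (p c) + ld * det3 (p a) (p b) (p d) = 0"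
    unfolding det3_eq using comp[of 1] comp[of 2] dep(1) by algebra
  then have "lc\<^sup>2 * (det3 (p a) (p b) (p c) * det3 (p a) (p b) (p d)) = - (lc * ld) * (det3 (p a) (p b) (p d))\<^sup>2"
    by algebra
  moreover have "det3 (p a) (p b) (p d) \<noteq> 0"
    using Q(2) by (simp add: det3_nonzero[OF gp])
  ultimately have "lc\<^sup>2 * (det3 (p a) (p b) (p c) * det3 (p a) (p b) (p d)) > 0"
    using opp by (simp add: mult_neg_pos)
  then have "det3 (p a) (p b) (p c) * det3 (p a) (p b) (p d) > 0"
    by (simp add: zero_less_mult_iff)
  then show ?thesis using wQ_quad[OF Q, of p] by simp
qed

text \<open>Each determinant identity forces two coefficients to vanish together; the pairs
  \<open>c d\<close>, \<open>b c\<close> and \<open>a b\<close> link all four.\<close>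

lemma dependence_nonzero:
  assumes gp: "general_position p" and dist: "distinct [a, b, c, d]"
    and dep: "la + lb + lc + ld = 0" "la *\<^sub>R p a + lb *\<^sub>R p b + lc *\<^sub>R p c + ld *\<^sub>R p d = 0"
    and ne: "la \<noteq> 0 \<or> lb \<noteq> 0 \<or> lc \<noteq> 0 \<or> ld \<noteq> 0"
  shows "la \<noteq> 0 \<and> lb \<noteq> 0 \<and> lc \<noteq> 0 \<and> ld \<noteq> 0"
proof -
  have comp: "la * p a $ k + lb * p b $ k + lc * p c $ k + ld * p d $ k = 0" for k
    using arg_cong[OF dep(2), of "\<lambda>x. x $ k"] by simp
  have "lc * det3 (p a) (p b) (p c) + ld * det3 (p a) (p b) (p d) = 0"
      "lb * det3 (p a) (p d) (p b) + lc * det3 (p a) (p d) (p c) = 0"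
      "la * det3 (p c) (p d) (p a) + lb * det3 (p c) (p d) (p b) = 0"
    unfolding det3_eq using comp[of 1] comp[of 2] dep(1) by algebra+
  moreover have "det3 (p a) (p b) (p c) \<noteq> 0" "det3 (p a) (p b) (p d) \<noteq> 0" "det3 (p a) (p d) (p b) \<noteq> 0"
      "det3 (p a) (p d) (p c) \<noteq> 0" "det3 (p c) (p d) (p a) \<noteq> 0" "det3 (p c) (p d) (p b) \<noteq> 0"
    using dist dist[THEN distinct_rev[THEN iffD2]] by (simp_all add: det3_nonzero[OF gp])
  ultimately show ?thesis using ne by (metis add_cancel_left_left add_cancel_right_left mult_eq_0_iff)
qed

text \<open>In equilibrium the force along \<open>ad\<close> balances the other two, so by the
  triangle inequality its length is at most the sum of theirs, whatever its sign.\<close>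

lemma alphaQ_nonneg:
  assumes gp: "general_position p" and Q: "Q = {a, b, c, d}" "distinct [a, b, c, d]"
    and pos: "wQ p Q a b > 0" "wQ p Q a c > 0"
  shows "alphaQ p Q a \<ge> 0"
proof -
  have Qa: "Q - {a} = {b, c, d}" and "card Q = 4" "a \<in> Q" and inQ: "b \<in> Q" "c \<in> Q" "d \<in> Q"
    using Q by auto
  then have "wQ p Q a b *\<^sub>R (p a - p b) + wQ p Q a c *\<^sub>R (p a - p c) + wQ p Q a d *\<^sub>R (p a - p d) = 0"
    using wQ_equilibrium[OF gp, of Q a] Q(2) by (simp add: add.assoc)
  then have "wQ p Q a d *\<^sub>R (p a - p d) = - (wQ p Q a b *\<^sub>R (p a - p b) + wQ p Q a c *\<^sub>R (p a - p c))"
    by (subst eq_neg_iff_add_eq_0) (simp only: add_ac)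
  then have "norm (wQ p Q a d *\<^sub>R (p a - p d)) \<le>
      norm (wQ p Q a b *\<^sub>R (p a - p b)) + norm (wQ p Q a c *\<^sub>R (p a - p c))"
    by (simp only: norm_minus_cancel norm_triangle_ineq)
  then have "- (wQ p Q a d * norm (p a - p d)) \<le>
      wQ p Q a b * norm (p a - p b) + wQ p Q a c * norm (p a - p c)"
    using pos by (smt (verit) norm_scaleR mult_right_mono norm_ge_zero real_norm_def mult_minus_left)
  moreover have "alphaQ p Q a = wQ p Q a b * norm (p a - p b) + wQ p Q a c * norm (p a - p c)
      + wQ p Q a d * norm (p a - p d)"
    using Q(2) \<open>a \<in> Q\<close> inQ
    by (simp add: alphaQ_def Qa wQ_commute[OF \<open>card Q = 4\<close>, of _ a] norm_minus_commute[of _ "p a"])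
  ultimately show ?thesis by linarith
qed

text \<open>The common point is an affine dependence with positive signs on \<open>a\<close>,
  \<open>b\<close> and negative ones on \<open>c\<close>, \<open>d\<close>. For each side of the
  quadrilateral the two remaining points have opposite signs, so \<open>wQ_pos\<close>
  applies.\<close>

lemma crossing_weights:
  assumes gp: "general_position p" and Q: "Q = {a, b, c, d}" "distinct [a, b, c, d]"
    and cross: "closed_segment (p a) (p b) \<inter> closed_segment (p c) (p d) \<noteq> {}"
  shows "wQ p Q a c > 0" "wQ p Q a d > 0" "wQ p Q b c > 0" "wQ p Q b d > 0"
proof -
  obtain u v where uv: "0 \<le> u" "u \<le> 1" "0 \<le> v" "v \<le> 1"
    and eq: "(1 - u) *\<^sub>R p a + u *\<^sub>R p b = (1 - v) *\<^sub>R p c + v *\<^sub>R p d"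
    using cross unfolding closed_segment_def by auto
  define la lb lc ld where l: "la = 1 - u" "lb = u" "lc = v - 1" "ld = - v"
  have sum: "la + lb + lc + ld = 0" by (simp add: l)
  have vec: "la *\<^sub>R p a + lb *\<^sub>R p b + lc *\<^sub>R p c + ld *\<^sub>R p d = 0"
    using eq by (simp add: l algebra_simps)
  have "la \<noteq> 0 \<and> lb \<noteq> 0 \<and> lc \<noteq> 0 \<and> ld \<noteq> 0"
    by (rule dependence_nonzero[OF gp Q(2) sum vec]) (auto simp: l)
  then have sgn: "la > 0" "lb > 0" "lc < 0" "ld < 0"
    using uv by (auto simp: l)
  show "wQ p Q a c > 0"
    by (rule wQ_pos[OF gp, of Q a c b d la lc lb ld])
      (use Q sum vec mult_pos_neg[OF sgn(2,4)] in \<open>auto simp: add_ac\<close>)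
  show "wQ p Q a d > 0"
    by (rule wQ_pos[OF gp, of Q a d b c la ld lb lc])
      (use Q sum vec mult_pos_neg[OF sgn(2,3)] in \<open>auto simp: add_ac\<close>)
  show "wQ p Q b c > 0"
    by (rule wQ_pos[OF gp, of Q b c a d lb lc la ld])
      (use Q sum vec mult_pos_neg[OF sgn(1,4)] in \<open>auto simp: add_ac\<close>)
  show "wQ p Q b d > 0"
    by (rule wQ_pos[OF gp, of Q b d a c lb ld la lc])
      (use Q sum vec mult_pos_neg[OF sgn(1,3)] in \<open>auto simp: add_ac\<close>)
qed

text \<open>The convex combination is a dependence whose only negative coefficient belongs to
  \<open>d\<close>. A hull edge leaves one hull vertex and \<open>d\<close>, hence opposite
  signs.\<close>

lemma interior_weights:
  assumes gp: "general_position p" and Q: "Q = {a, b, c, d}" "distinct [a, b, c, d]"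
    and int: "p d \<in> convex hull {p a, p b, p c}"
  shows "wQ p Q a b > 0" "wQ p Q a c > 0" "wQ p Q b c > 0"
proof -
  obtain u v w where uvw: "0 \<le> u" "0 \<le> v" "0 \<le> w" "u + v + w = 1"
    and eq: "p d = u *\<^sub>R p a + v *\<^sub>R p b + w *\<^sub>R p c"
    using int unfolding convex_hull_3 by auto
  define la lb lc ld where l: "la = u" "lb = v" "lc = w" "ld = - (1::real)"
  have sum: "la + lb + lc + ld = 0" using uvw by (simp add: l)
  have vec: "la *\<^sub>R p a + lb *\<^sub>R p b + lc *\<^sub>R p c + ld *\<^sub>R p d = 0"
    using eq by (simp add: l)
  have "la \<noteq> 0 \<and> lb \<noteq> 0 \<and> lc \<noteq> 0 \<and> ld \<noteq> 0"
    by (rule dependence_nonzero[OF gp Q(2) sum vec]) (auto simp: l)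
  then have sgn: "la > 0" "lb > 0" "lc > 0" "ld < 0"
    using uvw by (auto simp: l)
  show "wQ p Q a b > 0"
    by (rule wQ_pos[OF gp Q sum vec mult_pos_neg[OF sgn(3,4)]])
  show "wQ p Q a c > 0"
    by (rule wQ_pos[OF gp, of Q a c b d la lc lb ld])
      (use Q sum vec mult_pos_neg[OF sgn(2,4)] in \<open>auto simp: add_ac\<close>)
  show "wQ p Q b c > 0"
    by (rule wQ_pos[OF gp, of Q b c a d lb lc la ld])
      (use Q sum vec mult_pos_neg[OF sgn(1,4)] in \<open>auto simp: add_ac\<close>)
qed

section \<open>Excluding crossings and marked non-pointed vertices\<close>

text \<open>Every weight times its slack is nonnegative here, yet these products add up to minus the
  circuit value.\<close>

lemma tight_conflict_absurd:
  assumes gp: "general_position p" and card: "card Q = 4" and pos: "circuit_val p f f0 Q > 0"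
    and vt: "(v, t) \<in> Ybar p i1 i2 f f0"
    and edges: "\<And>i j. i \<in> Q \<Longrightarrow> j \<in> Q \<Longrightarrow> i < j \<Longrightarrow>
      inner (p i - p j) (v $ i - v $ j) - norm (p i - p j) * (t $ i + t $ j) = f i j \<or> wQ p Q i j > 0"
    and marks: "\<And>j. j \<in> Q \<Longrightarrow> t $ j = f0 j \<or> alphaQ p Q j \<ge> 0"
  shows False
proof -
  have "wQ p Q i j * (inner (p i - p j) (v $ i - v $ j) - norm (p i - p j) * (t $ i + t $ j) - f i j) \<ge> 0"
    if "i \<in> Q" "j \<in> Q" "i < j" for i j
  proof -
    have "inner (p i - p j) (v $ i - v $ j) - norm (p i - p j) * (t $ i + t $ j) - f i j \<ge> 0"
      using vt that by (simp add: Ybar_def)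
    then show ?thesis using edges[OF that] by (auto intro: mult_nonneg_nonneg)
  qed
  then have "(\<Sum>(i, j) \<in> {(i, j). i \<in> Q \<and> j \<in> Q \<and> i < j}.
      wQ p Q i j * (inner (p i - p j) (v $ i - v $ j) - norm (p i - p j) * (t $ i + t $ j) - f i j)) \<ge> 0"
    by (intro sum_nonneg) auto
  moreover have "(\<Sum>j \<in> Q. alphaQ p Q j * (t $ j - f0 j)) \<ge> 0"
  proof (rule sum_nonneg)
    fix j assume "j \<in> Q"
    then show "alphaQ p Q j * (t $ j - f0 j) \<ge> 0"
      using marks[of j] vt by (auto simp: Ybar_def)
  qed
  ultimately show False
    using circuit_val_slack[OF gp card, of "\<lambda>j. v $ j" "\<lambda>j. t $ j" f f0] pos by simp
qed

text \<open>If no open half-plane holds all edge directions, separation puts \<open>0\<close> in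
  their convex hull. Caratheodory reduces to at most three neighbours, and general position rules
  out fewer than three.\<close>

lemma not_pointed_obtain:
  assumes gp: "general_position p" and E: "\<And>i. (i, i) \<notin> E" and np: "\<not> pointed p E d"
  obtains a b c where "distinct [a, b, c, d]" "p d \<in> convex hull {p a, p b, p c}"
    "\<And>x. x \<in> {a, b, c} \<Longrightarrow> (x, d) \<in> E \<or> (d, x) \<in> E"
proof -
  define N where "N = {i. (i, d) \<in> E \<or> (d, i) \<in> E}"
  have inj: "inj p" using gp by (simp add: general_position_def)
  let ?S = "(\<lambda>i. p i - p d) ` N"
  have "0 \<in> convex hull ?S"
  proof (rule ccontr)
    assume "0 \<notin> convex hull ?S"
    moreover have "closed (convex hull ?S)"
      by (simp add: compact_imp_closed finite_imp_compact_convex_hull)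
    ultimately obtain u r where "r > 0" "\<forall>x\<in>convex hull ?S. inner u x > r"
      using separating_hyperplane_closed_0[of "convex hull ?S"] by auto
    then have "\<forall>i\<in>N. inner u (p i - p d) > 0"
      by (meson hull_inc image_eqI less_trans)
    then show False using np by (auto simp: pointed_def N_def)
  qed
  moreover have "convex hull ?S = (+) (- p d) ` (convex hull (p ` N))"
    by (subst convex_hull_translation[symmetric]) (simp add: image_image)
  ultimately have "p d \<in> convex hull (p ` N)"
    by (metis (no_types, lifting) add.commute eq_neg_iff_add_eq_0 imageE neg_equal_iff_equal)
  then obtain S where S: "finite S" "S \<subseteq> p ` N" "card S \<le> 3" "p d \<in> convex hull S"
    by (subst (asm) caratheodory) auto
  obtain A where A: "A \<subseteq> N" "S = p ` A"
    using S(2) by (meson subset_imageE)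
  have cA: "card A = card S"
    using inj A(2) by (metis card_image inj_on_subset subset_UNIV)
  have dA: "d \<notin> A" using A E by (auto simp: N_def)
  have "card A = 3"
  proof (rule ccontr)
    assume "card A \<noteq> 3"
    then consider "card A = 0" | "card A = 1" | "card A = 2" using S(3) cA by linarith
    then show False
    proof cases
      case 1
      then show False using S(4) A(2) by simp
    next
      case 2
      then obtain x where "A = {x}" by (auto simp: card_1_singleton_iff)
      then show False using S(4) A(2) dA inj by (auto dest: injD)
    next
      case 3
      then obtain x y where xy: "A = {x, y}" "x \<noteq> y" by (auto simp: card_2_iff)
      then have "p d \<in> closed_segment (p x) (p y)"
        using S(4) A(2) by (simp add: segment_convex_hull)
      then have "collinear {p x, p d, p y}"
        using between_imp_collinear between_mem_segment by blast
      then show False using gp dA xy unfolding general_position_def by auto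
    qed
  qed
  then obtain a b c where "A = {a, b, c}" "distinct [a, b, c]"
    by (auto simp: card_3_iff)
  then show thesis
    using dA A S(4) by (intro that[of a b c]) (auto simp: N_def)
qed

lemma tight_edgesD:
  assumes "(v, t) \<in> rel_interior F" "(i, j) \<in> tight_edges p f F"
  shows "i < j" "inner (p i - p j) (v $ i - v $ j) - norm (p i - p j) * (t $ i + t $ j) = f i j"
  using assms by (auto simp: tight_edges_def)

text \<open>A single point of the relative interior realizes all tight constraints at once, so it
  suffices to contradict \<open>circuit_val_slack\<close> there.\<close>

lemma non_crossing_if_circuit_val_pos:
  assumes gp: "general_position p" and pos: "\<And>Q. card Q = 4 \<Longrightarrow> circuit_val p f f0 Q > 0"
    and F: "F \<subseteq> Ybar p i1 i2 f f0" "(v, t) \<in> rel_interior F"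
  shows "non_crossing p (tight_edges p f F) (tight_marks f0 F)"
  unfolding non_crossing_def
proof (intro conjI ballI)
  have vt: "(v, t) \<in> Ybar p i1 i2 f f0"
    using F rel_interior_subset by blast
  fix e e' assume e: "e \<in> tight_edges p f F" "e' \<in> tight_edges p f F"
  obtain a b c d where abcd: "e = (a, b)" "e' = (c, d)" by force
  show "\<not> edges_cross p e e'"
  proof
    assume cross: "edges_cross p e e'"
    have lt: "a < b" "c < d" using e abcd by (auto simp: tight_edges_def)
    define Q where "Q = {a, b, c, d}"
    have dist: "distinct [a, b, c, d]" using cross lt by (auto simp: edges_cross_def abcd)
    have card: "card Q = 4" using dist by (simp add: Q_def)
    note w = crossing_weights[OF gp Q_def dist]
    have w: "wQ p Q a c > 0" "wQ p Q a d > 0" "wQ p Q b c > 0" "wQ p Q b d > 0"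
      using w cross by (auto simp: edges_cross_def abcd)
    have inQ: "a \<in> Q" "b \<in> Q" "c \<in> Q" "d \<in> Q" by (auto simp: Q_def)
    \<comment> \<open>How the labels of one edge compare with those of the other is unknown, so the
      weights are kept in both orientations.\<close>
    note w' = w w[unfolded wQ_commute[OF card inQ(1,3)] wQ_commute[OF card inQ(1,4)]
          wQ_commute[OF card inQ(2,3)] wQ_commute[OF card inQ(2,4)]]
    \<comment> \<open>Each endpoint has positive weights towards both ends of the other segment,
      which is what \<open>alphaQ_nonneg\<close> asks for.\<close>
    have alpha: "alphaQ p Q j \<ge> 0" if "j \<in> Q" for j
    proof -
      have "alphaQ p Q a \<ge> 0" by (rule alphaQ_nonneg[OF gp, of _ _ c d b]) (use w' dist in \<open>auto simp: Q_def\<close>)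
      moreover have "alphaQ p Q b \<ge> 0" by (rule alphaQ_nonneg[OF gp, of _ _ c d a]) (use w' dist in \<open>auto simp: Q_def\<close>)
      moreover have "alphaQ p Q c \<ge> 0" by (rule alphaQ_nonneg[OF gp, of _ _ a b d]) (use w' dist in \<open>auto simp: Q_def\<close>)
      moreover have "alphaQ p Q d \<ge> 0" by (rule alphaQ_nonneg[OF gp, of _ _ a b c]) (use w' dist in \<open>auto simp: Q_def\<close>)
      ultimately show ?thesis using that by (auto simp: Q_def)
    qed
    show False
    proof (rule tight_conflict_absurd[OF gp card pos[OF card] vt])
      fix i j assume "i \<in> Q" "j \<in> Q" "i < j"
      then show "inner (p i - p j) (v $ i - v $ j) - norm (p i - p j) * (t $ i + t $ j) = f i j \<or> wQ p Q i j > 0"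
        using w' lt tight_edgesD(2)[OF F(2) e(1)[unfolded abcd]] tight_edgesD(2)[OF F(2) e(2)[unfolded abcd]]
        by (auto simp: Q_def)
    qed (use alpha in auto)
  qed
next
  have vt: "(v, t) \<in> Ybar p i1 i2 f f0"
    using F rel_interior_subset by blast
  fix d assume d: "d \<in> tight_marks f0 F"
  then have td: "t $ d = f0 d" using F(2) by (auto simp: tight_marks_def)
  show "pointed p (tight_edges p f F) d"
  proof (rule ccontr)
    assume "\<not> pointed p (tight_edges p f F) d"
    then obtain a b c where dist: "distinct [a, b, c, d]" and hull: "p d \<in> convex hull {p a, p b, p c}"
      and E: "\<And>x. x \<in> {a, b, c} \<Longrightarrow> (x, d) \<in> tight_edges p f F \<or> (d, x) \<in> tight_edges p f F"
      by (rule not_pointed_obtain[OF gp, rotated]) (auto simp: tight_edges_def)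
    define Q where "Q = {a, b, c, d}"
    have card: "card Q = 4" using dist by (simp add: Q_def)
    note w = interior_weights[OF gp Q_def dist hull]
    have inQ: "a \<in> Q" "b \<in> Q" "c \<in> Q" by (auto simp: Q_def)
    note w' = w w[unfolded wQ_commute[OF card inQ(1,2)] wQ_commute[OF card inQ(1,3)]
          wQ_commute[OF card inQ(2,3)]]
    \<comment> \<open>Only the hull vertices need this: at \<open>d\<close> the mark is tight, so
      the sign of its coefficient does not matter.\<close>
    have "alphaQ p Q a \<ge> 0" by (rule alphaQ_nonneg[OF gp, of _ _ b c d]) (use w' dist in \<open>auto simp: Q_def\<close>)
    moreover have "alphaQ p Q b \<ge> 0" by (rule alphaQ_nonneg[OF gp, of _ _ a c d]) (use w' dist in \<open>auto simp: Q_def\<close>)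
    moreover have "alphaQ p Q c \<ge> 0" by (rule alphaQ_nonneg[OF gp, of _ _ a b d]) (use w' dist in \<open>auto simp: Q_def\<close>)
    ultimately have alpha: "t $ j = f0 j \<or> alphaQ p Q j \<ge> 0" if "j \<in> Q" for j
      using that td by (auto simp: Q_def)
    have tight: "inner (p i - p j) (v $ i - v $ j) - norm (p i - p j) * (t $ i + t $ j) = f i j"
      if "i < j" "i = d \<and> j \<in> {a, b, c} \<or> j = d \<and> i \<in> {a, b, c}" for i j
      using that E[of i] E[of j] tight_edgesD[OF F(2)] by (meson order.asym)
    show False
    proof (rule tight_conflict_absurd[OF gp card pos[OF card] vt])
      fix i j assume ij: "i \<in> Q" "j \<in> Q" "i < j"
      then show "inner (p i - p j) (v $ i - v $ j) - norm (p i - p j) * (t $ i + t $ j) = f i j \<or> wQ p Q i j > 0"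
        using w' tight[OF ij(3)] by (auto simp: Q_def)
    qed (use alpha in auto)
  qed
qed

subsection \<open>Quadruples with empty convex hull\<close>

text \<open>Induction on the number of configuration points in the hull: a point inside replaces a
  suitable hull vertex, and that vertex then leaves the hull.\<close>

lemma empty_counterexample:
  assumes gp: "general_position p" and "card Q\<^sub>0 = 4" "circuit_val p f f0 Q\<^sub>0 \<le> 0"
  obtains Q where "card Q = 4" "circuit_val p f f0 Q \<le> 0" "\<And>k. k \<notin> Q \<Longrightarrow> p k \<notin> convex hull (p ` Q)"
proof -
  have inj: "inj p" using gp by (simp add: general_position_def)
  have "\<exists>Q. card Q = 4 \<and> circuit_val p f f0 Q \<le> 0 \<and> (\<forall>k. k \<notin> Q \<longrightarrow> p k \<notin> convex hull (p ` Q))"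
    using assms(2,3)
  proof (induction "card {k. p k \<in> convex hull (p ` Q\<^sub>0)}" arbitrary: Q\<^sub>0 rule: less_induct)
    case (less Q)
    show ?case
    proof (cases "\<exists>x. x \<notin> Q \<and> p x \<in> convex hull (p ` Q)")
      case False
      then show ?thesis using less.prems by blast
    next
      case True
      then obtain x where x: "x \<notin> Q" "p x \<in> convex hull (p ` Q)" by blast
      define H where "H = convex hull (p ` Q)"
      define R where "R = insert x Q"
      have "finite Q" by simp
      then have cR: "card R = 5" using x less.prems by (simp add: R_def)
      obtain n c where aff: "\<And>i. i \<in> R \<Longrightarrow> circuit_val p f f0 (R - {i}) = inner n (p i) + c"
        using circuit_val_affine[OF gp cR, of f f0] by blast
      have "R - {x} = Q" using x by (auto simp: R_def)
      then have neg: "inner n (p x) + c \<le> 0" using aff[of x] less.prems by (simp add: R_def)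
      \<comment> \<open>An affine function that is positive at all extreme points is positive on the
        whole hull, but at \<open>p x\<close> its value is that of \<open>Q\<close> itself.\<close>
      have "\<exists>a\<in>Q. p a extreme_point_of H \<and> inner n (p a) + c \<le> 0"
      proof (rule ccontr)
        assume no: "\<not> ?thesis"
        have "{e. e extreme_point_of H} \<subseteq> {z. inner n z > - c}"
        proof
          fix e assume e: "e \<in> {e. e extreme_point_of H}"
          then have "e \<in> p ` Q" unfolding H_def by (auto dest: extreme_point_of_convex_hull)
          then show "e \<in> {z. inner n z > - c}" using no e by fastforce
        qed
        then have "convex hull {e. e extreme_point_of H} \<subseteq> {z. inner n z > - c}"
          by (rule hull_minimal) (rule convex_halfspace_gt)
        moreover have "H = convex hull {e. e extreme_point_of H}"
          unfolding H_def by (rule Krein_Milman_polytope) simp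
        ultimately show False using x(2) neg unfolding H_def[symmetric] by auto
      qed
      then obtain a where a: "a \<in> Q" "p a extreme_point_of H" "inner n (p a) + c \<le> 0" by blast
      define Q' where "Q' = R - {a}"
      have Q': "card Q' = 4" "circuit_val p f f0 Q' \<le> 0"
        using a aff[of a] cR by (auto simp: Q'_def R_def)
      have "p ` Q' \<subseteq> H - {p a}"
        using x inj hull_subset[of "p ` Q" convex] by (auto simp: Q'_def R_def H_def dest: injD)
      \<comment> \<open>Deleting an extreme point preserves convexity, so the new hull misses
        \<open>p a\<close> and the count drops strictly.\<close>
      moreover have "convex (H - {p a})"
        using a(2) extreme_point_of_stillconvex[of H] by (simp add: H_def)
      ultimately have sub: "convex hull (p ` Q') \<subseteq> H - {p a}" by (rule hull_minimal)
      have "p a \<in> H" using a(1) by (auto simp: H_def hull_inc)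
      with sub have "{k. p k \<in> convex hull (p ` Q')} \<subset> {k. p k \<in> H}" by blast
      then have "card {k. p k \<in> convex hull (p ` Q')} < card {k. p k \<in> H}"
        by (intro psubset_card_mono) auto
      then show ?thesis using less.hyps[of Q'] Q' by (simp add: H_def)
    qed
  qed
  then show ?thesis using that by blast
qed

subsection \<open>Constructing a face with a forbidden graph\<close>

lemma planar_solve:
  fixes x y :: "real^2"
  assumes "x$1 * y$2 - x$2 * y$1 \<noteq> 0"
  obtains v where "inner x v = r" "inner y v = s"
proof
  let ?D = "x$1 * y$2 - x$2 * y$1"
  \<comment> \<open>Cramer's rule.\<close>
  let ?v = "vector [(r * y$2 - s * x$2) / ?D, (s * x$1 - r * y$1) / ?D] :: real^2"
  show "inner x ?v = r"
    using assms by (simp add: inner_vec_def sum_2 divide_simps) algebra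
  show "inner y ?v = s"
    using assms by (simp add: inner_vec_def sum_2 divide_simps) algebra
qed

text \<open>Fix \<open>a\<close>, move \<open>b\<close> along \<open>ab\<close>, then solve two
  linear equations each for \<open>c\<close> and \<open>d\<close>. This settles five edges; the
  sixth follows from the balance condition because its weight is nonzero.\<close>

lemma realize_on_quad:
  assumes gp: "general_position p" and card: "card Q = 4"
    and sym: "\<And>i j. g i j = g j i"
    and eq: "(\<Sum>(i, j) \<in> {(i, j). i \<in> Q \<and> j \<in> Q \<and> i < j}. wQ p Q i j * g i j) = 0"
  obtains v where "\<And>i j. i \<in> Q \<Longrightarrow> j \<in> Q \<Longrightarrow> i \<noteq> j \<Longrightarrow> inner (p i - p j) (v i - v j) = g i j"
proof -
  obtain a where "a \<in> Q" using card by (metis all_not_in_conv card.empty zero_neq_numeral)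
  then obtain b c d where Q: "Q = {a, b, c, d}" and dist: "distinct [a, b, c, d]"
    using card_4_obtain[OF card] by metis
  have ne: "p b - p a \<noteq> 0" using gp dist by (auto simp: general_position_def dest: injD)
  define vb where "vb = (g b a / (norm (p b - p a))\<^sup>2) *\<^sub>R (p b - p a)"
  have vb: "inner (p b - p a) vb = g b a"
    using ne by (simp add: vb_def dot_square_norm)
  have nd: "(p x - p a)$1 * (p x - p b)$2 - (p x - p a)$2 * (p x - p b)$1 \<noteq> 0"
    if "x \<noteq> a" "x \<noteq> b" for x
    using det3_nonzero[OF gp, of a b x] that dist by (auto simp: det3_eq algebra_simps)
  obtain vc where vc: "inner (p c - p a) vc = g c a" "inner (p c - p b) vc = g c b + inner (p c - p b) vb"
    using planar_solve[OF nd[of c]] dist by auto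
  obtain vd where vd: "inner (p d - p a) vd = g d a" "inner (p d - p b) vd = g d b + inner (p d - p b) vb"
    using planar_solve[OF nd[of d]] dist by auto
  define v where "v = (\<lambda>_. 0)(b := vb, c := vc, d := vd)"
  have vs: "v a = 0" "v b = vb" "v c = vc" "v d = vd" using dist by (auto simp: v_def)
  define h where "h i j = inner (p i - p j) (v i - v j) - g i j" for i j
  have hsym: "h i j = h j i" for i j
    by (simp add: h_def sym[of i j] inner_diff algebra_simps)
  have h0: "h b a = 0" "h c a = 0" "h c b = 0" "h d a = 0" "h d b = 0"
    using vb vc vd by (simp_all add: h_def vs inner_diff_right)
  \<comment> \<open>The sums run over increasing pairs only, so the remaining edge \<open>cd\<close>
    must be put in order.\<close>
  define k l where "k = min c d" and "l = max c d"
  have kl: "k < l" "k = c \<and> l = d \<or> k = d \<and> l = c" using dist by (auto simp: k_def l_def min_def max_def)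
  let ?P = "{(i, j). i \<in> Q \<and> j \<in> Q \<and> i < j}"
  have "(\<Sum>(i, j) \<in> ?P. wQ p Q i j * h i j) = 0"
    using stress_work_zero[OF gp card, of v] eq
    by (simp add: h_def right_diff_distrib sum_subtractf case_prod_unfold)
  moreover have "(\<Sum>(i, j) \<in> ?P. wQ p Q i j * h i j) = (\<Sum>(i, j) \<in> {(k, l)}. wQ p Q i j * h i j)"
  proof (rule sum.mono_neutral_right)
    show "finite ?P" by simp
    show "{(k, l)} \<subseteq> ?P" using kl Q by auto
    show "\<forall>x\<in>?P - {(k, l)}. (case x of (i, j) \<Rightarrow> wQ p Q i j * h i j) = 0"
      using kl h0 h0[THEN trans[OF hsym]] by (auto simp: Q)
  qed
  moreover have "wQ p Q k l \<noteq> 0"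
  proof -
    have "Q = {k, l, a, b}" "distinct [k, l, a, b]" using Q dist kl by auto
    then have "wQ p Q k l = 1 / (det3 (p k) (p l) (p a) * det3 (p k) (p l) (p b))"
        "det3 (p k) (p l) (p a) \<noteq> 0" "det3 (p k) (p l) (p b) \<noteq> 0"
      by (rule wQ_quad, insert \<open>distinct [k, l, a, b]\<close>, simp_all add: det3_nonzero[OF gp])
    then show ?thesis by simp
  qed
  ultimately have "h k l = 0" by simp
  then have "h c d = 0" "h d c = 0" using kl(2) hsym by auto
  with h0 h0[THEN trans[OF hsym]] have "h i j = 0" if "i \<in> Q" "j \<in> Q" "i \<noteq> j" for i j
    using that unfolding Q by auto
  then show thesis by (intro that[of v]) (simp add: h_def)
qed

section \<open>Extending the motion to the remaining points\<close>

lemma eventually_quadratic_ge: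
  fixes A B b c :: real
  assumes "A > 0 \<or> A \<ge> 0 \<and> B > 0"
  shows "eventually (\<lambda>N. b \<le> c + N\<^sup>2 * A + N * B) at_top"
proof (cases "A > 0")
  case True
  show ?thesis
    \<comment> \<open>\<open>B\<close> may be negative here. The bound makes
      \<open>N * A + B\<close> at least \<open>\<bar>b - c\<bar>\<close>, and a further factor
      \<open>N \<ge> 1\<close> preserves this.\<close>
    using eventually_ge_at_top[of "max 1 ((\<bar>b - c\<bar> + \<bar>B\<bar>) / A)"]
  proof eventually_elim
    case (elim N)
    then have "N \<ge> 1" "\<bar>b - c\<bar> + \<bar>B\<bar> \<le> N * A" using True by (auto simp: field_simps)
    then have "\<bar>b - c\<bar> \<le> N * A + B" by linarith
    also have "\<dots> \<le> N * (N * A + B)"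
      using \<open>N \<ge> 1\<close> calculation by (intro mult_le_cancel_right1[THEN iffD2]) auto
    finally show ?case by (simp add: power2_eq_square algebra_simps)
  qed
next
  case False
  then have AB: "A \<ge> 0" "B > 0" using assms by auto
  show ?thesis
    using eventually_ge_at_top[of "\<bar>b - c\<bar> / B"]
  proof eventually_elim
    case (elim N)
    then have "\<bar>b - c\<bar> \<le> N * B" using AB by (simp add: field_simps)
    moreover have "N\<^sup>2 * A \<ge> 0" using AB by simp
    ultimately show ?case by linarith
  qed
qed

text \<open>Off \<open>Q\<close> the points move along \<open>x \<mapsto> x - closest_point K x\<close>, where \<open>K\<close> is the hull of the
  fixed points. This field is monotone, strictly so between \<open>K\<close> and its complement; the
  lower-order dilation makes it strict between two points outside \<open>K\<close> as well.\<close>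
lemma extend_off_hull:
  fixes p :: "'i::finite \<Rightarrow> real^2"
  assumes inj: "inj p" and Qne: "Q \<noteq> {}" and empty: "\<And>k. k \<notin> Q \<Longrightarrow> p k \<notin> convex hull (p ` Q)"
  obtains v where "\<And>i. i \<in> Q \<Longrightarrow> v i = v\<^sub>0 i"
    "\<And>i j. i \<noteq> j \<Longrightarrow> \<not> (i \<in> Q \<and> j \<in> Q) \<Longrightarrow> b i j \<le> inner (p i - p j) (v i - v j)"
proof -
  define K where "K = convex hull (p ` Q)"
  define c where "c = closest_point K"
  have K: "convex K" "closed K" "K \<noteq> {}"
    using Qne by (auto simp: K_def intro!: compact_imp_closed finite_imp_compact_convex_hull)
  have cK: "c x \<in> K" for x
    unfolding c_def using K by (intro closest_point_in_set) auto
  have dot: "inner (x - c x) (y - c x) \<le> 0" if "y \<in> K" for x y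
    unfolding c_def using K that by (intro closest_point_dot) auto
  have pK: "p i \<in> K" if "i \<in> Q" for i using that by (auto simp: K_def hull_inc)
  have npK: "p i \<notin> K" if "i \<notin> Q" for i using that empty by (auto simp: K_def)
  define X where "X i = (if i \<in> Q then 0 else p i - c (p i))" for i
  define W where "W i = (if i \<in> Q then 0 else p i)" for i
  \<comment> \<open>Both fields vanish on \<open>Q\<close>, so the given motion survives there.
    Between a point of \<open>Q\<close> and one outside, the term from \<open>W\<close> has no
    definite sign; the higher power of \<open>N\<close> lets \<open>X\<close> dominate it.\<close>
  define V where "V N i = (if i \<in> Q then v\<^sub>0 i else 0) + N\<^sup>2 *\<^sub>R X i + N *\<^sub>R W i" for N i
  have in_out: "inner (p i - p j) (X i - X j) > 0" if "i \<in> Q" "j \<notin> Q" for i j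
  proof -
    have "inner (p i - p j) (X i - X j) = inner (p j - c (p j)) (p j - c (p j)) - inner (p j - c (p j)) (p i - c (p j))"
      using that by (simp add: X_def inner_diff inner_commute algebra_simps)
    moreover have "p j - c (p j) \<noteq> 0" using cK[of "p j"] npK[OF that(2)] by auto
    then have "inner (p j - c (p j)) (p j - c (p j)) > 0" by simp
    ultimately show ?thesis using dot[OF pK[OF that(1)], of "p j"] by linarith
  qed
  have mono: "inner (p i - p j) (X i - X j) \<ge> 0" if "i \<notin> Q" "j \<notin> Q" for i j
  proof -
    \<comment> \<open>With residuals \<open>p i - c (p i)\<close> the product is the square of their
      difference plus two terms, each nonnegative by the obtuse angle at a closest point.\<close>
    have "inner (p i - p j) (X i - X j) =
        inner ((p i - c (p i)) - (p j - c (p j))) ((p i - c (p i)) - (p j - c (p j)))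
        - inner (p i - c (p i)) (c (p j) - c (p i)) - inner (p j - c (p j)) (c (p i) - c (p j))"
      using that by (simp add: X_def inner_diff inner_commute algebra_simps)
    moreover have "inner ((p i - c (p i)) - (p j - c (p j))) ((p i - c (p i)) - (p j - c (p j))) \<ge> 0"
      by simp
    ultimately show ?thesis using dot[OF cK, of "p i" "p j"] dot[OF cK, of "p j" "p i"] by linarith
  qed
  have "eventually (\<lambda>N. b i j \<le> inner (p i - p j) (V N i - V N j)) at_top"
    if ij: "i \<noteq> j" "\<not> (i \<in> Q \<and> j \<in> Q)" for i j
  proof -
    define A where "A = inner (p i - p j) (X i - X j)"
    define B where "B = inner (p i - p j) (W i - W j)"
    have "A > 0 \<or> A \<ge> 0 \<and> B > 0"
    proof (cases "i \<in> Q \<or> j \<in> Q")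
      case True
      have "inner (p i - p j) (X i - X j) = inner (p j - p i) (X j - X i)"
        by (simp add: inner_diff algebra_simps)
      then show ?thesis using True ij in_out[of i j] in_out[of j i] by (auto simp: A_def)
    next
      case False
      then have "B = inner (p i - p j) (p i - p j)" by (simp add: B_def W_def)
      moreover have "p i - p j \<noteq> 0" using ij inj by (auto dest: injD)
      ultimately have "B > 0" by simp
      then show ?thesis using False mono by (auto simp: A_def)
    qed
    then have "eventually (\<lambda>N. b i j \<le> inner (p i - p j) ((if i \<in> Q then v\<^sub>0 i else 0) - (if j \<in> Q then v\<^sub>0 j else 0))
        + N\<^sup>2 * A + N * B) at_top"
      by (rule eventually_quadratic_ge)
    moreover have "inner (p i - p j) (V N i - V N j) =
        inner (p i - p j) ((if i \<in> Q then v\<^sub>0 i else 0) - (if j \<in> Q then v\<^sub>0 j else 0)) + N\<^sup>2 * A + N * B" for N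
      by (simp add: V_def A_def B_def inner_add_right inner_diff_right right_diff_distrib)
    ultimately show ?thesis by simp
  qed
  then have "eventually (\<lambda>N. \<forall>(i, j) \<in> {(i, j). i \<noteq> j \<and> \<not> (i \<in> Q \<and> j \<in> Q)}.
      b i j \<le> inner (p i - p j) (V N i - V N j)) at_top"
    by (intro eventually_ball_finite) auto
  then obtain N where N: "\<forall>(i, j) \<in> {(i, j). i \<noteq> j \<and> \<not> (i \<in> Q \<and> j \<in> Q)}.
      b i j \<le> inner (p i - p j) (V N i - V N j)"
    using eventually_happens'[OF trivial_limit_at_top_linorder] by blast
  show thesis
    by (rule that[of "V N"]) (use N in \<open>auto simp: V_def X_def W_def\<close>)
qed

text \<open>Subtract an infinitesimal rigid motion, which no edge functional sees: a translation
  fixes \<open>i1\<close>, and the rotation rate \<open>r\<close> kills the first coordinate at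
  \<open>i2\<close>. Solving for \<open>r\<close> needs distinct second coordinates.\<close>

lemma normalize_motion:
  fixes p v :: "'i \<Rightarrow> real^2"
  assumes "p i1 $ 2 \<noteq> p i2 $ 2"
  obtains v' where "\<And>i j. inner (p i - p j) (v' i - v' j) = inner (p i - p j) (v i - v j)"
    "v' i1 = 0" "v' i2 $ 1 = 0"
proof -
  define J where "J x = (vector [- x$2, x$1] :: real^2)" for x :: "real^2"
  define r where "r = (v i2 - v i1)$1 / (p i1 $ 2 - p i2 $ 2)"
  define v' where "v' i = v i - v i1 - r *\<^sub>R J (p i - p i1)" for i
  have J: "inner x (J x) = 0" "J x - J y = J (x - y)" for x y
    by (auto simp: J_def inner_vec_def sum_2 vec_eq_iff forall_2)
  show thesis
  proof (rule that[of v'])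
    fix i j
    have "v' i - v' j = (v i - v j) - r *\<^sub>R (J (p i - p i1) - J (p j - p i1))"
      by (simp add: v'_def algebra_simps)
    also have "J (p i - p i1) - J (p j - p i1) = J (p i - p j)" by (simp add: J(2))
    finally show "inner (p i - p j) (v' i - v' j) = inner (p i - p j) (v i - v j)"
      by (simp add: inner_diff_right J(1))
    show "v' i1 = 0" by (simp add: v'_def J_def vec_eq_iff forall_2)
    show "v' i2 $ 1 = 0" using assms by (simp add: v'_def J_def r_def field_simps)
  qed
qed

lemma exists_tight_point:
  assumes gp: "general_position p" and norm: "p i1 $ 2 \<noteq> p i2 $ 2"
    and card: "card Q = 4" and le: "circuit_val p f f0 Q \<le> 0"
    and empty: "\<And>k. k \<notin> Q \<Longrightarrow> p k \<notin> convex hull (p ` Q)"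
    and ab: "a \<in> Q" "b \<in> Q" "a \<noteq> b" and w: "wQ p Q a b > 0"
  obtains v t where "(v, t) \<in> Ybar p i1 i2 f f0" "\<And>j. t $ j = f0 j"
    "\<And>i j. i \<in> Q \<Longrightarrow> j \<in> Q \<Longrightarrow> i < j \<Longrightarrow> {i, j} \<noteq> {a, b} \<Longrightarrow>
       inner (p i - p j) (v $ i - v $ j) - norm (p i - p j) * (t $ i + t $ j) = f i j"
proof -
  \<comment> \<open>The slack left on the edge \<open>ab\<close>: multiplied by its weight it
    compensates the circuit value exactly, and the signs make it nonnegative.\<close>
  define s where "s = - circuit_val p f f0 Q / wQ p Q a b"
  have s: "s \<ge> 0" using le w by (simp add: s_def divide_nonpos_pos)
  \<comment> \<open>Target values that make every mark and every edge other than \<open>ab\<close>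
    tight. Taking \<open>min\<close> and \<open>max\<close> makes \<open>g\<close> symmetric, since
    \<open>f\<close> matters only on increasing pairs.\<close>
  define g where "g i j = f (min i j) (max i j) + norm (p i - p j) * (f0 i + f0 j)
      + (if {i, j} = {a, b} then s else 0)" for i j
  have gsym: "g i j = g j i" for i j
    by (simp add: g_def min.commute max.commute norm_minus_commute add.commute insert_commute)
  define k l where "k = min a b" and "l = max a b"
  have kl: "k < l" "k = a \<and> l = b \<or> k = b \<and> l = a" using ab by (auto simp: k_def l_def min_def max_def)
  let ?P = "{(i, j). i \<in> Q \<and> j \<in> Q \<and> i < j}"
  have "(\<Sum>(i, j) \<in> ?P. wQ p Q i j * g i j) =
      (\<Sum>(i, j) \<in> ?P. wQ p Q i j * (f i j + norm (p i - p j) * (f0 i + f0 j))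
         + (if (i, j) = (k, l) then wQ p Q a b * s else 0))"
  proof (rule sum.cong[OF refl])
    fix x assume "x \<in> ?P"
    then obtain i j where x: "x = (i, j)" "i < j" by auto
    have "{i, j} = {a, b} \<longleftrightarrow> (i, j) = (k, l)"
      using x kl by (auto simp: doubleton_eq_iff)
    moreover have "wQ p Q k l = wQ p Q a b" using kl wQ_commute[OF card ab(1,2)] by auto
    ultimately show "(case x of (i, j) \<Rightarrow> wQ p Q i j * g i j) = (case x of (i, j) \<Rightarrow>
        wQ p Q i j * (f i j + norm (p i - p j) * (f0 i + f0 j))
         + (if (i, j) = (k, l) then wQ p Q a b * s else 0))"
      using x by (auto simp: g_def algebra_simps)
  qed
  also have "\<dots> = circuit_val p f f0 Q + (\<Sum>x \<in> ?P. if x = (k, l) then wQ p Q a b * s else 0)"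
    unfolding circuit_val_eq[OF card] sum.distrib[symmetric] by (intro sum.cong) (auto split: if_splits)
  also have "(\<Sum>x \<in> ?P. if x = (k, l) then wQ p Q a b * s else 0) = wQ p Q a b * s"
  proof -
    have "finite ?P" "(k, l) \<in> ?P" using kl ab by auto
    then show ?thesis by (simp only: sum.delta if_True)
  qed
  also have "circuit_val p f f0 Q + wQ p Q a b * s = 0" using w by (simp add: s_def)
  finally have balanced: "(\<Sum>(i, j) \<in> ?P. wQ p Q i j * g i j) = 0" .
  obtain v\<^sub>0 where v\<^sub>0: "\<And>i j. i \<in> Q \<Longrightarrow> j \<in> Q \<Longrightarrow> i \<noteq> j \<Longrightarrow> inner (p i - p j) (v\<^sub>0 i - v\<^sub>0 j) = g i j"
    using realize_on_quad[where g = g, OF gp card gsym balanced] by blast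
  have inj: "inj p" using gp by (simp add: general_position_def)
  have "Q \<noteq> {}" using ab by auto
  \<comment> \<open>Taking \<open>g\<close> also as the lower bound off \<open>Q\<close> secures all
    remaining constraints.\<close>
  from extend_off_hull[OF inj this empty, of v\<^sub>0 g] obtain v\<^sub>1 where
    v\<^sub>1: "\<And>i. i \<in> Q \<Longrightarrow> v\<^sub>1 i = v\<^sub>0 i"
      "\<And>i j. i \<noteq> j \<Longrightarrow> \<not> (i \<in> Q \<and> j \<in> Q) \<Longrightarrow> g i j \<le> inner (p i - p j) (v\<^sub>1 i - v\<^sub>1 j)" by blast
  obtain v\<^sub>2 where v\<^sub>2: "\<And>i j. inner (p i - p j) (v\<^sub>2 i - v\<^sub>2 j) = inner (p i - p j) (v\<^sub>1 i - v\<^sub>1 j)"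
    "v\<^sub>2 i1 = 0" "v\<^sub>2 i2 $ 1 = 0"
    using normalize_motion[where p = p and v = v\<^sub>1, OF norm] by blast
  have in_Q: "inner (p i - p j) (v\<^sub>2 i - v\<^sub>2 j) = g i j" if "i \<in> Q" "j \<in> Q" "i \<noteq> j" for i j
    using that by (simp add: v\<^sub>2 v\<^sub>1 v\<^sub>0)
  have ge: "g i j \<le> inner (p i - p j) (v\<^sub>2 i - v\<^sub>2 j)" if "i \<noteq> j" for i j
    using that in_Q[of i j] v\<^sub>1(2)[of i j] by (cases "i \<in> Q \<and> j \<in> Q") (auto simp: v\<^sub>2(1))
  have g_ge: "f i j + norm (p i - p j) * (f0 i + f0 j) \<le> g i j" if "i < j" for i j
    using that s by (simp add: g_def)
  show thesis
  proof (rule that[of "\<chi> i. v\<^sub>2 i" "\<chi> i. f0 i"])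
    show "(\<chi> i. v\<^sub>2 i, \<chi> i. f0 i) \<in> Ybar p i1 i2 f f0"
    proof -
      have "f i j \<le> inner (p i - p j) (v\<^sub>2 i - v\<^sub>2 j) - norm (p i - p j) * (f0 i + f0 j)" if "i < j" for i j
        using ge[OF less_imp_neq[OF that]] g_ge[OF that] by linarith
      then show ?thesis using v\<^sub>2(2,3) by (simp add: Ybar_def)
    qed
  qed (use in_Q in \<open>auto simp: g_def\<close>)
qed

section \<open>Faces cut out by tight constraints\<close>

text \<open>A valid inequality that is tight inside a segment is tight at both ends, since the two
  nonnegative slacks average to zero with positive weights.\<close>

lemma face_of_tight:
  fixes c :: "'k \<Rightarrow> 'a::real_vector \<Rightarrow> real"
  assumes lin: "\<And>k. linear (c k)" and "convex Y"
    and ge: "\<And>k y. k \<in> K \<Longrightarrow> y \<in> Y \<Longrightarrow> b k \<le> c k y"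
  shows "{y \<in> Y. \<forall>k\<in>K. c k y = b k} face_of Y"
  unfolding face_of_def
proof (intro conjI ballI impI)
  have comb: "c k ((1 - u) *\<^sub>R x + u *\<^sub>R y) = (1 - u) * c k x + u * c k y" for k u x y
    by (simp add: linear_add[OF lin] linear_scale[OF lin])
  have "{y \<in> Y. \<forall>k\<in>K. c k y = b k} = Y \<inter> (\<Inter>k\<in>K. {y. c k y = b k})" by auto
  moreover have "convex {y. c k y = b k}" for k
    using convex_linear_vimage[OF lin[of k] convex_singleton[of "b k"]] by (simp add: vimage_def)
  ultimately show "convex {y \<in> Y. \<forall>k\<in>K. c k y = b k}"
    using \<open>convex Y\<close> by (auto intro!: convex_Int convex_INT)
  have tight: "c k x = b k \<and> c k y = b k"
    if z: "x \<in> Y" "y \<in> Y" "z \<in> open_segment x y" "c k z = b k" "k \<in> K" for x y z k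
  proof -
    obtain u where u: "0 < u" "u < 1" "z = (1 - u) *\<^sub>R x + u *\<^sub>R y"
      using z(3) by (auto simp: in_segment)
    have "(1 - u) * (c k x - b k) + u * (c k y - b k) = 0"
      using z(4) unfolding u(3) comb by (simp add: algebra_simps)
    moreover have "c k x - b k \<ge> 0" "c k y - b k \<ge> 0" using ge z by auto
    ultimately show ?thesis
      using u by (smt (verit, best) mult_nonneg_nonneg mult_pos_pos)
  qed
  fix x y z assume *: "x \<in> Y" "y \<in> Y" "z \<in> {y \<in> Y. \<forall>k\<in>K. c k y = b k}" "z \<in> open_segment x y"
  show "x \<in> {y \<in> Y. \<forall>k\<in>K. c k y = b k}" "y \<in> {y \<in> Y. \<forall>k\<in>K. c k y = b k}"
    using * tight[OF *(1,2,4)] by auto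
qed auto

lemma Ybar_tight_face:
  fixes p :: "'i::{finite,linorder} \<Rightarrow> real^2"
  assumes E: "\<And>i j. (i, j) \<in> E \<Longrightarrow> i < j"
  shows "{(v, t) \<in> Ybar p i1 i2 f f0.
      (\<forall>(i, j) \<in> E. inner (p i - p j) (v $ i - v $ j) - norm (p i - p j) * (t $ i + t $ j) = f i j)
      \<and> (\<forall>j \<in> M. t $ j = f0 j)} face_of Ybar p i1 i2 f f0"
proof -
  \<comment> \<open>The disjoint sum merges edges (\<open>Inl\<close>) and marks
    (\<open>Inr\<close>) into one family of linear constraints.\<close>
  define c where "c k y = (case k of
      Inl (i, j) \<Rightarrow> inner (p i - p j) (fst y $ i - fst y $ j) - norm (p i - p j) * (snd y $ i + snd y $ j)
    | Inr j \<Rightarrow> snd y $ j)" for k :: "'i \<times> 'i + 'i" and y :: "((real^2)^'i::{finite,linorder}) \<times> (real^'i::{finite,linorder})"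
  define b where "b k = (case k of Inl (i, j) \<Rightarrow> f i j | Inr j \<Rightarrow> f0 j)" for k :: "'i \<times> 'i + 'i"
  have lin: "linear (c k)" for k
    by (rule linearI)
      (auto simp: c_def inner_add_right inner_diff_right algebra_simps split: sum.splits prod.splits)
  have lin': "linear (\<lambda>y::((real^2)^'i::{finite,linorder}) \<times> (real^'i::{finite,linorder}). fst y $ i $ m)" for i m
    by (rule linearI) auto
  define C where "C = {k :: 'i \<times> 'i + 'i. \<forall>i j. k = Inl (i, j) \<longrightarrow> i < j}"
  have Y: "Ybar p i1 i2 f f0 = {y. fst y $ i1 $ 1 = 0} \<inter> {y. fst y $ i1 $ 2 = 0} \<inter> {y. fst y $ i2 $ 1 = 0}
      \<inter> (\<Inter>k\<in>C. {y. c k y \<ge> b k})" (is "_ = ?R")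
  proof -
    have "(\<forall>k\<in>C. c k (v, t) \<ge> b k) \<longleftrightarrow> (\<forall>i j. i < j \<longrightarrow>
           inner (p i - p j) (v $ i - v $ j) - norm (p i - p j) * (t $ i + t $ j) \<ge> f i j) \<and>
        (\<forall>j. t $ j \<ge> f0 j)" for v t
      by (auto simp: C_def c_def b_def split: sum.splits)
    then show ?thesis by (simp add: set_eq_iff Ybar_def)
  qed
  have "convex {y. c k y \<ge> b k}" for k
    using convex_linear_vimage[OF lin[of k] convex_real_interval(1)[of "b k"]] by (simp add: vimage_def)
  moreover have "convex {y::((real^2)^'i::{finite,linorder}) \<times> (real^'i::{finite,linorder}). fst y $ i $ m = 0}" for i m
    using convex_linear_vimage[OF lin'[of i m] convex_singleton[of 0]] by (simp add: vimage_def)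
  ultimately have "convex (Ybar p i1 i2 f f0)"
    unfolding Y by (intro convex_Int convex_INT) auto
  moreover have "b k \<le> c k y" if "k \<in> Inl ` E \<union> Inr ` M" "y \<in> Ybar p i1 i2 f f0" for k y
    using that E unfolding Y C_def by blast
  ultimately have "{y \<in> Ybar p i1 i2 f f0. \<forall>k\<in>Inl ` E \<union> Inr ` M. c k y = b k} face_of Ybar p i1 i2 f f0"
    by (intro face_of_tight lin)
  moreover have "{y \<in> Ybar p i1 i2 f f0. \<forall>k\<in>Inl ` E \<union> Inr ` M. c k y = b k} =
      {(v, t) \<in> Ybar p i1 i2 f f0.
      (\<forall>(i, j) \<in> E. inner (p i - p j) (v $ i - v $ j) - norm (p i - p j) * (t $ i + t $ j) = f i j)
      \<and> (\<forall>j \<in> M. t $ j = f0 j)}"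
    by (auto simp: ball_Un c_def b_def)
  ultimately show ?thesis by simp
qed

section \<open>Validity forces positive circuit values\<close>

text \<open>Four points in the plane have a Radon partition: two against two is a crossing, one
  against three an interior point, and none against four is impossible as one hull would be
  empty.\<close>

lemma quad_radon:
  assumes gp: "general_position p" and card: "card Q = 4"
  obtains a b c d where "Q = {a, b, c, d}" "distinct [a, b, c, d]"
    "closed_segment (p a) (p b) \<inter> closed_segment (p c) (p d) \<noteq> {} \<or> p d \<in> convex hull {p a, p b, p c}"
proof -
  note result = that
  have inj: "inj p" using gp by (simp add: general_position_def)
  have "card (p ` Q) = 4" using inj card by (metis card_image inj_on_subset subset_UNIV)
  then have "affine_dependent (p ` Q)"
    by (intro affine_dependent_biggerset) auto
  then obtain M P where MP: "M \<inter> P = {}" "M \<union> P = p ` Q" "convex hull M \<inter> convex hull P \<noteq> {}"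
    using Radon_partition[of "p ` Q"] by auto
  define A B where "A = {i \<in> Q. p i \<in> M}" and "B = {i \<in> Q. p i \<in> P}"
  have im: "p ` A = M" "p ` B = P" using MP by (auto simp: A_def B_def)
  have AB: "A \<union> B = Q" "A \<inter> B = {}" using MP by (auto simp: A_def B_def)
  then have cAB: "card A + card B = 4" using card by (metis card_Un_disjoint finite)
  have ne: "convex hull (p ` A) \<inter> convex hull (p ` B) \<noteq> {}" using MP im by simp
  have one: thesis if *: "card A' = 1" "card B' = 3" "A' \<union> B' = Q" "A' \<inter> B' = {}"
    "convex hull (p ` A') \<inter> convex hull (p ` B') \<noteq> {}" for A' B'
  proof -
    obtain d where "A' = {d}" using *(1) by (auto simp: card_1_singleton_iff)
    moreover obtain a b c where "B' = {a, b, c}" "distinct [a, b, c]"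
      using *(2) by (auto simp: card_3_iff)
    ultimately show thesis using *(3-5) by (intro result[of a b c d]) auto
  qed
  consider "card A = 0 \<or> card B = 0" | "card A = 1" "card B = 3" | "card B = 1" "card A = 3"
    | "card A = 2" "card B = 2" using cAB by linarith
  then show thesis
  proof cases
    case 1 then show thesis using ne by auto
  next
    case 2 then show thesis using one[of A B] AB ne by blast
  next
    case 3 then show thesis using one[of B A] AB ne by blast
  next
    case 4
    then obtain a b c d where "A = {a, b}" "a \<noteq> b" "B = {c, d}" "c \<noteq> d" by (auto simp: card_2_iff)
    then show thesis
      using AB ne by (intro result[of a b c d]) (auto simp: segment_convex_hull)
  qed
qed

lemma circuit_val_pos_if_valid:
  assumes gp: "general_position p" and norm: "p i1 $ 2 \<noteq> p i2 $ 2"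
    and valid: "valid p i1 i2 f f0" and "card Q\<^sub>0 = 4"
  shows "circuit_val p f f0 Q\<^sub>0 > 0"
proof (rule ccontr)
  assume "\<not> ?thesis"
  then have "circuit_val p f f0 Q\<^sub>0 \<le> 0" by simp
  from empty_counterexample[OF gp assms(4) this] obtain Q where card: "card Q = 4" and le: "circuit_val p f f0 Q \<le> 0"
    and empty: "\<And>k. k \<notin> Q \<Longrightarrow> p k \<notin> convex hull (p ` Q)"
    by blast
  have tight: "\<exists>E. non_crossing p E UNIV
      \<and> (\<forall>i\<in>Q. \<forall>j\<in>Q. i < j \<and> {i, j} \<noteq> {a, b} \<longrightarrow> (i, j) \<in> E)"
    if ab: "a \<in> Q" "b \<in> Q" "a \<noteq> b" "wQ p Q a b > 0" for a b
  proof (rule exists_tight_point[where a = a and b = b, OF gp norm card le empty ab])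
    fix v t
    assume vt: "(v, t) \<in> Ybar p i1 i2 f f0" "\<And>j. t $ j = f0 j"
      "\<And>i j. i \<in> Q \<Longrightarrow> j \<in> Q \<Longrightarrow> i < j \<Longrightarrow> {i, j} \<noteq> {a, b} \<Longrightarrow>
       inner (p i - p j) (v $ i - v $ j) - norm (p i - p j) * (t $ i + t $ j) = f i j"
    \<comment> \<open>The face may have further tight edges; this is harmless, because both kinds of
      conflict persist when edges are added.\<close>
    define E where "E = {(i, j). i \<in> Q \<and> j \<in> Q \<and> i < j \<and> {i, j} \<noteq> {a, b}}"
    define F where "F = {(v, t) \<in> Ybar p i1 i2 f f0.
      (\<forall>(i, j) \<in> E. inner (p i - p j) (v $ i - v $ j) - norm (p i - p j) * (t $ i + t $ j) = f i j)
      \<and> (\<forall>j \<in> UNIV. t $ j = f0 j)}"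
    have "F face_of Ybar p i1 i2 f f0"
      unfolding F_def by (rule Ybar_tight_face) (auto simp: E_def)
    moreover have "(v, t) \<in> F" unfolding F_def using vt by (simp add: E_def)
    ultimately have "non_crossing p (tight_edges p f F) (tight_marks f0 F)"
      using valid[unfolded valid_def, rule_format, of F] by auto
    moreover have F: "(v, t) \<in> F" if "(v, t) \<in> rel_interior F" for v t
      using that rel_interior_subset by blast
    then have "tight_marks f0 F = UNIV"
      unfolding tight_marks_def F_def by fast
    moreover have "(i, j) \<in> tight_edges p f F" if "(i, j) \<in> E" for i j
    proof -
      have "i < j" using that by (simp add: E_def)
      moreover have "inner (p i - p j) (v $ i - v $ j) - norm (p i - p j) * (t $ i + t $ j) = f i j"
        if "(v, t) \<in> rel_interior F" for v t
        using F[OF that] \<open>(i, j) \<in> E\<close> unfolding F_def by fast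
      ultimately show ?thesis unfolding tight_edges_def by blast
    qed
    ultimately have "non_crossing p (tight_edges p f F) UNIV"
        "\<forall>i\<in>Q. \<forall>j\<in>Q. i < j \<and> {i, j} \<noteq> {a, b} \<longrightarrow> (i, j) \<in> tight_edges p f F"
      by (auto simp: E_def)
    then show ?thesis by blast
  qed
  obtain a b c d where Q: "Q = {a, b, c, d}" and dist: "distinct [a, b, c, d]"
    and radon: "closed_segment (p a) (p b) \<inter> closed_segment (p c) (p d) \<noteq> {} \<or> p d \<in> convex hull {p a, p b, p c}"
    using quad_radon[OF gp card] .
  from radon show False
  proof
    assume cross: "closed_segment (p a) (p b) \<inter> closed_segment (p c) (p d) \<noteq> {}"
    \<comment> \<open>The edge that stays slack is a side of the quadrilateral, so both diagonals
      are tight.\<close>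
    have "wQ p Q a c > 0" using crossing_weights(1)[OF gp Q dist cross] .
    moreover have "a \<in> Q" "c \<in> Q" "a \<noteq> c" using Q dist by auto
    ultimately obtain E where E: "non_crossing p E UNIV"
      "\<And>i j. i \<in> Q \<Longrightarrow> j \<in> Q \<Longrightarrow> i < j \<Longrightarrow> {i, j} \<noteq> {a, c} \<Longrightarrow> (i, j) \<in> E"
      using tight[of a c] by blast
    have "(min a b, max a b) \<in> E" "(min c d, max c d) \<in> E"
      using dist by (auto intro!: E(2) simp: Q min_def max_def doubleton_eq_iff)
    moreover have "edges_cross p (min a b, max a b) (min c d, max c d)"
      using cross dist by (auto simp: edges_cross_def min_def max_def closed_segment_commute)
    ultimately show False using E(1) unfolding non_crossing_def by blast
  next
    assume int: "p d \<in> convex hull {p a, p b, p c}"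
    \<comment> \<open>Here a hull edge stays slack, and all three edges at the marked point
      \<open>d\<close> are tight.\<close>
    have "wQ p Q a b > 0" using interior_weights(1)[OF gp Q dist int] .
    moreover have "a \<in> Q" "b \<in> Q" "a \<noteq> b" using Q dist by auto
    ultimately obtain E where E: "non_crossing p E UNIV"
      "\<And>i j. i \<in> Q \<Longrightarrow> j \<in> Q \<Longrightarrow> i < j \<Longrightarrow> {i, j} \<noteq> {a, b} \<Longrightarrow> (i, j) \<in> E"
      using tight[of a b] by blast
    have "(x, d) \<in> E \<or> (d, x) \<in> E" if "x \<in> {a, b, c}" for x
      using that dist E(2)[of x d] E(2)[of d x] by (cases x d rule: linorder_cases) (auto simp: Q doubleton_eq_iff)
    moreover obtain u where "\<And>i. (i, d) \<in> E \<or> (d, i) \<in> E \<Longrightarrow> inner u (p i - p d) > 0"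
      using E(1) unfolding non_crossing_def pointed_def by blast
    \<comment> \<open>Pointedness puts the three neighbours in an open half-plane bounded by a line
      through \<open>p d\<close>, hence also their hull, which contains \<open>p d\<close>.\<close>
    ultimately have "{p a, p b, p c} \<subseteq> {x. inner u x > inner u (p d)}"
      by (auto simp: inner_diff_right)
    then have "convex hull {p a, p b, p c} \<subseteq> {x. inner u x > inner u (p d)}"
      by (rule hull_minimal) (rule convex_halfspace_gt)
    then show False using int by auto
  qed
qed

theorem mainTheorem17:
  fixes p :: "'i::{finite,linorder} \<Rightarrow> real^2"
    and i1 i2 :: 'i
    and f :: "'i \<Rightarrow> 'i \<Rightarrow> real" and f0 :: "'i \<Rightarrow> real"
  assumes "CARD('i) \<ge> 4"
    and "general_position p"
    and "i1 \<noteq> i2"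
    and "p i1 $ 2 \<noteq> p i2 $ 2"
  shows "valid p i1 i2 f f0 \<longleftrightarrow>
    (\<forall>Q. card Q = 4 \<longrightarrow>
       (\<Sum>(i, j) \<in> {(i, j). i \<in> Q \<and> j \<in> Q \<and> i < j}. wQ p Q i j * f i j)
       + (\<Sum>j \<in> Q. alphaQ p Q j * f0 j) > 0)"
  unfolding circuit_val_def[symmetric]
proof (intro iffI allI impI)
  show "circuit_val p f f0 Q > 0" if "valid p i1 i2 f f0" "card Q = 4" for Q
    using circuit_val_pos_if_valid[OF assms(2,4) that] .
next
  assume pos: "\<forall>Q. card Q = 4 \<longrightarrow> circuit_val p f f0 Q > 0"
  show "valid p i1 i2 f f0"
    unfolding valid_def
  proof (intro allI impI, elim conjE)
    fix F assume F: "F face_of Ybar p i1 i2 f f0" "F \<noteq> {}"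
    \<comment> \<open>Without a relative interior point every constraint would count as tight
      vacuously; convexity of a nonempty face provides one.\<close>
    then have "rel_interior F \<noteq> {}"
      using rel_interior_eq_empty face_of_imp_convex by blast
    then obtain v t where "(v, t) \<in> rel_interior F" by auto
    then show "non_crossing p (tight_edges p f F) (tight_marks f0 F)"
      using pos F by (intro non_crossing_if_circuit_val_pos[OF assms(2)]) (auto dest: face_of_imp_subset)
  qed
qed

end
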